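(* As $C^*$-subalgebras of $C(\Sigma_\infty)\cong(\mathbb C^3)^{\otimes\infty}$, with $C(K)$ embedded via $f\mapsto f\circ P$, $$C(K)=\{a\in(\mathbb C^3)^{\otimes\infty}:\ a=\lim_{n\to\infty}\varphi_n(a_n)\ \text{in norm, for some sequence } a_n\in\mathbb C(V_n)\}.$$
   Context: Indices $j\in\{1,2,3\}$ are taken mod $3$. Let $v_1,v_2,v_3$ be the vertices of an equilateral triangle in $\mathbb R^2$. For $j=1,2,3$ let $w_j:\mathbb R^2\to\mathbb R^2$ be the similitude of ratio $1/2$ (the affine map) with $w_j(v_2)=v_j$, $w_j(v_3)=\tfrac12(v_j+v_{j+1})$, $w_j(v_1)=\tfrac12(v_j+v_{j-1})$. The Sierpinski gasket $K$ is the unique nonempty compact set with $K=w_1(K)\cup w_2(K)\cup w_3(K)$. Put $V_0=\{v_1,v_2,v_3\}$, $V_{n+1}=\bigcup_j w_j(V_n)$; $\mathbb C(V_n)$ is the algebra of complex functions on $V_n$. Let $\Sigma_\infty=\{1,2,3\}^{\mathbb N}$ with the product topology, whose elements are infinite words $\sigma=\sigma_1\sigma_2\cdots$. The inductive limit $C^*$-algebra $(\mathbb C^3)^{\otimes\infty}$ (with embeddings $x\mapsto x\otimes 1$) is identified with $C(\Sigma_\infty)$. The map $P:\Sigma_\infty\to K$ is the continuous surjection sending $\sigma$ to the unique point of $\bigcap_n w_{\sigma_1}\circ\cdots\circ w_{\sigma_n}(K)$. The injective unital $*$-homomorphism $\varphi_n:\mathbb C(V_n)\to(\mathbb C^3)^{\otimes(n+1)}\subset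 C(\Sigma_\infty)$ is $\varphi_n(f)(\sigma)=f\big(w_{\sigma_1}\circ\cdots\circ w_{\sigma_n}(v_{\sigma_{n+1}})\big)$. *)

theory Defs
  imports "HOL-Analysis.Analysis"
begin

text \<open>
  Indices live in the numeral type \<open>3\<close>, the integers modulo 3, so that \<open>j + 1\<close> and \<open>j - 1\<close> are
  taken mod 3 and \<open>3 = 0\<close>.  An infinite word \<open>\<sigma>\<^sub>1\<sigma>\<^sub>2\<dots>\<close> is a function \<open>\<sigma> :: nat \<Rightarrow> 3\<close>, counted from
  zero: the letter \<open>\<sigma>\<^sub>i\<close> is \<open>\<sigma> (i - 1)\<close>.
\<close>

definition similitude :: "real \<Rightarrow> (real^2 \<Rightarrow> real^2) \<Rightarrow> bool" where
  "similitude r f \<longleftrightarrow> (\<forall>x y. dist (f x) (f y) = r * dist x y)"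

primrec vertices :: "(3 \<Rightarrow> real^2) \<Rightarrow> (3 \<Rightarrow> real^2 \<Rightarrow> real^2) \<Rightarrow> nat \<Rightarrow> (real^2) set" where
  "vertices v w 0 = {v 1, v 2, v 3}"
| "vertices v w (Suc n) = (\<Union>j. w j ` vertices v w n)"

text \<open>The composition \<open>w\<^bsub>\<sigma>\<^sub>1\<^esub> \<circ> \<dots> \<circ> w\<^bsub>\<sigma>\<^sub>n\<^esub>\<close>.\<close>

primrec word_map :: "(3 \<Rightarrow> real^2 \<Rightarrow> real^2) \<Rightarrow> (nat \<Rightarrow> 3) \<Rightarrow> nat \<Rightarrow> real^2 \<Rightarrow> real^2" where
  "word_map w \<sigma> 0 = id"
| "word_map w \<sigma> (Suc n) = word_map w \<sigma> n \<circ> w (\<sigma> n)"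

definition coding_map ::
    "(3 \<Rightarrow> real^2 \<Rightarrow> real^2) \<Rightarrow> (real^2) set \<Rightarrow> (nat \<Rightarrow> 3) \<Rightarrow> real^2" where
  "coding_map w K \<sigma> = (THE x. x \<in> (\<Inter>n. word_map w \<sigma> n ` K))"

definition word_space :: "(nat \<Rightarrow> 3) topology" where
  "word_space = product_topology (\<lambda>_. discrete_topology UNIV) UNIV"

text \<open>
  Functions on a set are represented extensionally (\<open>undefined\<close> outside of it), so that elements of
  \<open>cont_functions X\<close> correspond exactly to the continuous complex functions on \<open>X\<close>.
\<close>

definition cont_functions :: "'a topology \<Rightarrow> ('a \<Rightarrow> complex) set" where
  "cont_functions X = {f \<in> topspace X \<rightarrow>\<^sub>E UNIV. continuous_map X euclidean f}"

text \<open>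
  The algebra \<open>C(\<Sigma>\<^sub>\<infinity>)\<close>, identified with the inductive limit of the algebras \<open>(\<complex>\<^sup>3)\<^sup>\<otimes>\<^sup>n\<close> of functions
  of the first \<open>n\<close> letters.
\<close>

abbreviation word_algebra :: "((nat \<Rightarrow> 3) \<Rightarrow> complex) set" where
  "word_algebra \<equiv> cont_functions word_space"

definition sup_norm :: "('a \<Rightarrow> complex) \<Rightarrow> real" where
  "sup_norm a = (SUP x. cmod (a x))"

definition norm_limit :: "(nat \<Rightarrow> 'a \<Rightarrow> complex) \<Rightarrow> ('a \<Rightarrow> complex) \<Rightarrow> bool" where
  "norm_limit b a \<longleftrightarrow> (\<lambda>n. sup_norm (\<lambda>x. b n x - a x)) \<longlonglongrightarrow> 0"

definition cstar_subalgebra :: "((nat \<Rightarrow> 3) \<Rightarrow> complex) set \<Rightarrow> bool" where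
  "cstar_subalgebra A \<longleftrightarrow>
     A \<subseteq> word_algebra \<and>
     (\<lambda>_. 0) \<in> A \<and>
     (\<forall>a\<in>A. \<forall>b\<in>A. (\<lambda>\<sigma>. a \<sigma> + b \<sigma>) \<in> A) \<and>
     (\<forall>c. \<forall>a\<in>A. (\<lambda>\<sigma>. c * a \<sigma>) \<in> A) \<and>
     (\<forall>a\<in>A. \<forall>b\<in>A. (\<lambda>\<sigma>. a \<sigma> * b \<sigma>) \<in> A) \<and>
     (\<forall>a\<in>A. (\<lambda>\<sigma>. cnj (a \<sigma>)) \<in> A) \<and>
     (\<forall>b. \<forall>a\<in>word_algebra. (\<forall>n. b n \<in> A) \<longrightarrow> norm_limit b a \<longrightarrow> a \<in> A)"

definition vertex_embedding ::
    "(3 \<Rightarrow> real^2) \<Rightarrow> (3 \<Rightarrow> real^2 \<Rightarrow> real^2) \<Rightarrow> nat \<Rightarrow>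
      (real^2 \<Rightarrow> complex) \<Rightarrow> (nat \<Rightarrow> 3) \<Rightarrow> complex" where
  "vertex_embedding v w n f \<sigma> = f (word_map w \<sigma> n (v (\<sigma> n)))"

definition gasket_embedding ::
    "(3 \<Rightarrow> real^2 \<Rightarrow> real^2) \<Rightarrow> (real^2) set \<Rightarrow>
      (real^2 \<Rightarrow> complex) \<Rightarrow> (nat \<Rightarrow> 3) \<Rightarrow> complex" where
  "gasket_embedding w K f = f \<circ> coding_map w K"

end

theory Submission
  imports Defs
begin

text \<open>
  Since the coding map \<open>P\<close> is a quotient map, \<open>C(K)\<close> consists of the continuous functions on words that
  are constant on the fibres of \<open>P\<close>.  The point at which \<open>\<phi>\<^sub>n\<close> evaluates lies within
  \<open>diam K / 2\<^sup>n\<close> of \<open>P \<sigma>\<close>, so by uniform continuity every \<open>f \<circ> P\<close> is the limit of the \<open>\<phi>\<^sub>n (f|V\<^sub>n)\<close>.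
  Conversely, two distinct words with the same image under \<open>P\<close> have, up to exchange, the form
  \<open>u j 3 2 2 2 \<dots>\<close> and \<open>u (j + 1) 1 2 2 2 \<dots>\<close>, because two cells of the gasket meet only in a vertex.
  As \<open>v\<^sub>2\<close> is fixed by \<open>w\<^sub>2\<close> and \<open>w\<^sub>j v\<^sub>3 = w\<^bsub>j+1\<^esub> v\<^sub>1\<close>, the evaluation points of such words agree for all
  large \<open>n\<close>, so the limits are constant on the fibres.
\<close>

section \<open>Compactness of the word space and the sup norm\<close>

lemma topspace_word_space: "topspace word_space = UNIV"
  by (simp add: word_space_def)

lemma compact_word_space: "compact_space word_space"
  by (simp add: word_space_def compact_space_product_topology compact_space_discrete_topology)

lemma openin_cylinder: "openin word_space {\<tau>. \<forall>i<n. \<tau> i = \<sigma> i}"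
proof -
  have "{\<tau>. \<forall>i<n. \<tau> i = \<sigma> i} = (\<Pi>\<^sub>E i\<in>UNIV. if i < n then {\<sigma> i} else UNIV)"
    unfolding PiE_UNIV_domain by (auto simp: Pi_iff split: if_split_asm)
  moreover have "finite {i. (if i < n then {\<sigma> i} else UNIV) \<noteq> (UNIV :: 3 set)}"
    by (rule finite_subset[of _ "{..<n}"]) auto
  ultimately show ?thesis
    unfolding word_space_def by (simp only:) (rule product_topology_basis, simp_all)
qed

lemma word_algebra_iff: "a \<in> word_algebra \<longleftrightarrow> continuous_map word_space euclidean a"
  by (simp add: cont_functions_def topspace_word_space)

lemma bounded_range_word_algebra:
  assumes "a \<in> word_algebra"
  shows "bounded (range a)"
proof -
  have "compactin euclidean (a ` topspace word_space)"
    using assms compact_word_space unfolding word_algebra_iff compact_space_def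
    by (rule image_compactin[rotated])
  then show ?thesis
    by (simp add: topspace_word_space compact_imp_bounded)
qed

text \<open>A real \<open>SUP\<close> is an upper bound only for a family that is bounded above, so
  boundedness accompanies every use of \<open>sup_norm\<close>.\<close>

lemma cmod_le_sup_norm:
  assumes "bounded (range a)"
  shows "cmod (a x) \<le> sup_norm a"
proof -
  obtain B where "\<And>x. cmod (a x) \<le> B"
    using assms unfolding bounded_iff by blast
  then have "bdd_above (range (\<lambda>x. cmod (a x)))"
    by (intro bdd_aboveI2)
  then show ?thesis
    unfolding sup_norm_def by (rule cSUP_upper[OF UNIV_I])
qed

lemma norm_limit_pointwise:
  assumes lim: "norm_limit b a"
    and bdd: "\<And>n. bounded (range (b n))" "bounded (range a)"
  shows "(\<lambda>n. b n x) \<longlonglongrightarrow> a x"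
proof -
  have le: "norm (b n x - a x) \<le> sup_norm (\<lambda>x. b n x - a x)" for n
    by (rule cmod_le_sup_norm) (rule bounded_minus_comp[OF bdd(1) bdd(2)])
  have "(\<lambda>n. b n x - a x) \<longlonglongrightarrow> 0"
  proof (rule Lim_null_comparison)
    show "\<forall>\<^sub>F n in sequentially. norm (b n x - a x) \<le> sup_norm (\<lambda>x. b n x - a x)"
      by (rule always_eventually) (intro allI le)
    show "(\<lambda>n. sup_norm (\<lambda>x. b n x - a x)) \<longlonglongrightarrow> 0"
      using lim by (simp only: norm_limit_def)
  qed
  then show ?thesis
    by (simp add: LIM_zero_iff)
qed

lemma norm_limitI:
  assumes "\<And>e. e > 0 \<Longrightarrow> \<exists>N. \<forall>n\<ge>N. \<forall>x. cmod (b n x - a x) \<le> e"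
  shows "norm_limit b a"
  unfolding norm_limit_def
proof (rule LIMSEQ_I)
  fix r :: real assume "r > 0"
  \<comment> \<open>A supremum inherits only the weak bound; halving \<open>r\<close> makes the
    final inequality strict.\<close>
  then obtain N where N: "\<And>n x. n \<ge> N \<Longrightarrow> cmod (b n x - a x) \<le> r / 2"
    using assms[OF half_gt_zero] by blast
  have "norm (sup_norm (\<lambda>x. b n x - a x) - 0) < r" if "n \<ge> N" for n
  proof -
    have "sup_norm (\<lambda>x. b n x - a x) \<le> r / 2"
      unfolding sup_norm_def by (rule cSUP_least) (use N[OF that] in simp_all)
    moreover have "0 \<le> sup_norm (\<lambda>x. b n x - a x)"
    proof -
      have "bounded (range (\<lambda>x. b n x - a x))"
        using N[OF that] unfolding bounded_iff by blast
      then show ?thesis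
        by (rule order_trans[OF norm_ge_zero cmod_le_sup_norm])
    qed
    ultimately show ?thesis
      using \<open>r > 0\<close> by simp
  qed
  then show "\<exists>N. \<forall>n\<ge>N. norm (sup_norm (\<lambda>x. b n x - a x) - 0) < r"
    by blast
qed

section \<open>Word maps and the evaluation points of the vertex embeddings\<close>

lemma word_map_Suc_shift: "word_map w \<sigma> (Suc n) = w (\<sigma> 0) \<circ> word_map w (\<sigma> \<circ> Suc) n"
proof (induction n)
  case (Suc n)
  have "word_map w \<sigma> (Suc (Suc n)) = word_map w \<sigma> (Suc n) \<circ> w (\<sigma> (Suc n))"
    by simp
  also have "\<dots> = w (\<sigma> 0) \<circ> word_map w (\<sigma> \<circ> Suc) (Suc n)"
    unfolding Suc by (simp add: comp_assoc)
  finally show ?case .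
qed simp

definition vertex_point ::
    "(3 \<Rightarrow> real^2) \<Rightarrow> (3 \<Rightarrow> real^2 \<Rightarrow> real^2) \<Rightarrow> nat \<Rightarrow> (nat \<Rightarrow> 3) \<Rightarrow> real^2" where
  "vertex_point v w n \<sigma> = word_map w \<sigma> n (v (\<sigma> n))"

lemma vertex_point_0: "vertex_point v w 0 \<sigma> = v (\<sigma> 0)"
  by (simp add: vertex_point_def)

text \<open>\<open>word_map\<close> recurses at its innermost map. Splitting off the outermost one
  instead lets inductions over all words pass to the tail
  \<open>\<sigma> \<circ> Suc\<close>.\<close>

lemma vertex_point_Suc: "vertex_point v w (Suc n) \<sigma> = w (\<sigma> 0) (vertex_point v w n (\<sigma> \<circ> Suc))"
  by (simp add: vertex_point_def word_map_Suc_shift del: word_map.simps)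

lemma vertex_embedding_eq: "vertex_embedding v w n f = f \<circ> vertex_point v w n"
  by (auto simp: vertex_embedding_def vertex_point_def)

lemma vertex_point_in_vertices: "vertex_point v w n \<sigma> \<in> vertices v w n"
proof (induction n arbitrary: \<sigma>)
  case 0
  then show ?case
    using exhaust_3[of "\<sigma> 0"] by (auto simp: vertex_point_0)
qed (auto simp: vertex_point_Suc)

lemma finite_vertices: "finite (vertices v w n)"
  by (induction n) auto

text \<open>Only the finitely many values of \<open>f\<close> on the level-\<open>n\<close> vertices
  occur. This supplies the boundedness required by \<open>norm_limit_pointwise\<close>.\<close>

lemma bounded_range_vertex_embedding: "bounded (range (vertex_embedding v w n f))"
proof (rule finite_imp_bounded, rule finite_subset)
  show "range (vertex_embedding v w n f) \<subseteq> f ` vertices v w n"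
    by (auto simp: vertex_embedding_eq vertex_point_in_vertices)
qed (simp add: finite_vertices)

section \<open>The coding map of a self-similar compact set with ratio 1/2\<close>

locale half_ifs =
  fixes w :: "3 \<Rightarrow> real^2 \<Rightarrow> real^2" and K :: "(real^2) set"
  assumes similitude: "similitude (1/2) (w j)"
    and nonempty: "K \<noteq> {}" and compact: "compact K"
    and self_similar: "K = w 1 ` K \<union> w 2 ` K \<union> w 3 ` K"
begin

abbreviation P :: "(nat \<Rightarrow> 3) \<Rightarrow> real^2" where
  "P \<equiv> coding_map w K"

lemma dist_w: "dist (w j x) (w j y) = dist x y / 2"
  using similitude[of j] by (simp add: similitude_def)

lemma w_inject: "w j x = w j y \<longleftrightarrow> x = y"
  using dist_w[of j x y] by (metis dist_eq_0_iff divide_eq_0_iff zero_neq_numeral)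

lemma continuous_w: "continuous_on S (w j)"
proof (rule continuous_onI)
  fix x e assume "e > (0::real)"
  then show "\<exists>d>0. \<forall>x'\<in>S. dist x' x < d \<longrightarrow> dist (w j x') (w j x) \<le> e"
    by (intro exI[of _ e]) (auto simp: dist_w)
qed

lemma w_in_K: "x \<in> K \<Longrightarrow> w j x \<in> K"
  using exhaust_3[of j] by (intro equalityD2[OF self_similar, THEN subsetD]) auto

lemma K_cases:
  assumes "x \<in> K"
  obtains j y where "y \<in> K" "x = w j y"
  using equalityD1[OF self_similar, THEN subsetD, OF assms] by blast

lemma dist_le_diameter: "x \<in> K \<Longrightarrow> y \<in> K \<Longrightarrow> dist x y \<le> diameter K"
  using compact compact_imp_bounded diameter_bounded_bound by blast

lemma small_scale:
  assumes "e > 0"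
  shows "\<exists>N. \<forall>n\<ge>N. diameter K / 2 ^ n < e"
proof -
  have "(\<lambda>n. diameter K * (1/2) ^ n) \<longlonglongrightarrow> diameter K * 0"
    by (intro tendsto_intros LIMSEQ_power_zero) auto
  then have "\<forall>\<^sub>F n in sequentially. diameter K * (1/2) ^ n < e"
    using assms by (intro order_tendstoD) auto
  then show ?thesis
    by (simp add: eventually_sequentially power_one_over)
qed

lemma dist_word_map: "dist (word_map w \<sigma> n x) (word_map w \<sigma> n y) = dist x y / 2 ^ n"
  by (induction n arbitrary: x y) (auto simp: dist_w)

lemma continuous_word_map: "continuous_on S (word_map w \<sigma> n)"
proof (induction n arbitrary: S)
  case (Suc n)
  then show ?case
    using continuous_on_compose[OF continuous_w Suc] by (simp add: comp_def)
qed (simp add: continuous_on_id)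

lemma word_map_image_antimono: "m \<le> n \<Longrightarrow> word_map w \<sigma> n ` K \<subseteq> word_map w \<sigma> m ` K"
proof (induction rule: dec_induct)
  case (step n)
  have "word_map w \<sigma> (Suc n) ` K \<subseteq> word_map w \<sigma> n ` K"
    by (auto simp: w_in_K)
  then show ?case
    using step by blast
qed auto

text \<open>Cantor's intersection theorem: the cells are nested, closed and of diameter at most
  \<open>diameter K / 2 ^ n\<close>. It makes the definite description in \<open>coding_map\<close>
  meaningful.\<close>

lemma coding_singleton: "\<exists>a. (\<Inter>n. word_map w \<sigma> n ` K) = {a}"
proof (rule decreasing_closed_nest_sing)
  show "closed (word_map w \<sigma> n ` K)" for n
    by (intro compact_imp_closed compact_continuous_image continuous_word_map compact)
  fix e :: real assume "e > 0"
  then obtain n where n: "diameter K / 2 ^ n < e"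
    using small_scale[of e] by blast
  have "dist x y / 2 ^ n < e" if "x \<in> K" "y \<in> K" for x y
    using dist_le_diameter[OF that] n
    by (meson divide_right_mono le_less_trans zero_le_numeral zero_le_power)
  then show "\<exists>n. \<forall>x\<in>word_map w \<sigma> n ` K. \<forall>y\<in>word_map w \<sigma> n ` K. dist x y < e"
    by (intro exI[of _ n]) (auto simp: dist_word_map)
next
  show "word_map w \<sigma> n ` K \<noteq> {}" for n
    using nonempty by blast
qed (rule word_map_image_antimono)

lemma coding_eqI:
  assumes "\<And>n. x \<in> word_map w \<sigma> n ` K"
  shows "P \<sigma> = x"
proof -
  obtain a where a: "(\<Inter>n. word_map w \<sigma> n ` K) = {a}"
    using coding_singleton by blast
  moreover have "x \<in> (\<Inter>n. word_map w \<sigma> n ` K)"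
    using assms by blast
  ultimately show ?thesis
    by (simp add: coding_map_def)
qed

lemma coding_mem: "P \<sigma> \<in> word_map w \<sigma> n ` K"
proof -
  obtain a where a: "(\<Inter>n. word_map w \<sigma> n ` K) = {a}"
    using coding_singleton by blast
  then have "P \<sigma> = a"
    by (simp add: coding_map_def)
  then show ?thesis
    using a by blast
qed

lemma coding_in_K: "P \<sigma> \<in> K"
  using coding_mem[of \<sigma> 0] by simp

text \<open>A cell of level \<open>Suc m\<close> is the image under \<open>w (\<sigma> 0)\<close> of
  the level-\<open>m\<close> cell of the tail. Later inductions on words use this recursion for
  \<open>P\<close>.\<close>

lemma coding_shift: "P \<sigma> = w (\<sigma> 0) (P (\<sigma> \<circ> Suc))"
proof (rule coding_eqI)
  fix n show "w (\<sigma> 0) (P (\<sigma> \<circ> Suc)) \<in> word_map w \<sigma> n ` K"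
  proof (cases n)
    case 0
    then show ?thesis by (simp add: w_in_K coding_in_K)
  next
    case (Suc m)
    then show ?thesis
      using coding_mem[of "\<sigma> \<circ> Suc" m]
      by (auto simp: word_map_Suc_shift simp del: word_map.simps)
  qed
qed

lemma dist_coding:
  assumes "\<forall>i<n. \<sigma> i = \<tau> i"
  shows "dist (P \<sigma>) (P \<tau>) \<le> diameter K / 2 ^ n"
  using assms
proof (induction n arbitrary: \<sigma> \<tau>)
  case 0
  then show ?case by (simp add: dist_le_diameter coding_in_K)
next
  case (Suc n)
  have "dist (P (\<sigma> \<circ> Suc)) (P (\<tau> \<circ> Suc)) \<le> diameter K / 2 ^ n"
    using Suc.prems by (intro Suc.IH) auto
  moreover have "\<sigma> 0 = \<tau> 0"
    using Suc.prems by simp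
  ultimately show ?case
    by (simp add: coding_shift[of \<sigma>] coding_shift[of \<tau>] dist_w)
qed

lemma coding_surj: "range P = K"
proof
  show "K \<subseteq> range P"
  proof
    fix x assume x: "x \<in> K"
    have "\<exists>j y. z \<in> K \<longrightarrow> y \<in> K \<and> z = w j y" for z
      using K_cases by metis
    then obtain g h where gh: "\<And>z. z \<in> K \<Longrightarrow> h z \<in> K \<and> z = w (g z) (h z)"
      by metis
    \<comment> \<open>The address of \<open>x\<close> is its itinerary: \<open>g\<close> chooses a
      cell containing a point and \<open>h\<close> its preimage in \<open>K\<close>, so the n-th
      letter is \<open>g\<close> of the n-th iterate.\<close>
    define \<sigma> where "\<sigma> n = g ((h ^^ n) x)" for n
    have "(h ^^ n) x \<in> K \<and> x = word_map w \<sigma> n ((h ^^ n) x)" for n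
    proof (induction n)
      case (Suc n)
      then show ?case
        using gh[of "(h ^^ n) x"] by (simp add: \<sigma>_def)
    qed (simp add: x)
    then have "P \<sigma> = x"
      by (intro coding_eqI) blast
    then show "x \<in> range P" by blast
  qed
qed (auto simp: coding_in_K)

lemma continuous_coding: "continuous_map word_space (top_of_set K) P"
proof -
  have "openin word_space {\<sigma>. P \<sigma> \<in> U}" if "open U" for U
  proof (subst openin_subopen, intro ballI)
    fix \<sigma> assume "\<sigma> \<in> {\<sigma>. P \<sigma> \<in> U}"
    then obtain e where e: "e > 0" "ball (P \<sigma>) e \<subseteq> U"
      using \<open>open U\<close> open_contains_ball by blast
    then obtain n where n: "diameter K / 2 ^ n < e"
      using small_scale[of e] by blast
    have "P \<tau> \<in> U" if "\<forall>i<n. \<tau> i = \<sigma> i" for \<tau>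
    proof -
      have "dist (P \<sigma>) (P \<tau>) < e"
        using dist_coding[of n \<sigma> \<tau>] that n by simp
      then show ?thesis using e by auto
    qed
    then show "\<exists>T. openin word_space T \<and> \<sigma> \<in> T \<and> T \<subseteq> {\<sigma>. P \<sigma> \<in> U}"
      using openin_cylinder[of n \<sigma>] by blast
  qed
  then have "continuous_map word_space euclidean P"
    by (simp add: continuous_map_def topspace_word_space)
  then show ?thesis
    by (auto simp: continuous_map_in_subtopology coding_in_K)
qed

section \<open>The image of \<open>C(K)\<close> in the word algebra\<close>

lemma quotient_coding: "quotient_map word_space (top_of_set K) P"
  by (rule continuous_imp_quotient_map)
    (auto simp: continuous_coding compact_word_space Hausdorff_space_subtopology
      topspace_word_space coding_surj)

lemma inj_gasket_embedding: "inj_on (gasket_embedding w K) (cont_functions (top_of_set K))"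
proof (rule inj_onI)
  fix f g
  assume fg: "f \<in> cont_functions (top_of_set K)" "g \<in> cont_functions (top_of_set K)"
    and eq: "gasket_embedding w K f = gasket_embedding w K g"
  have "f x = g x" if "x \<in> K" for x
    using eq that coding_surj unfolding gasket_embedding_def by (metis comp_apply imageE)
  then show "f = g"
    using fg unfolding cont_functions_def by (auto intro: PiE_ext)
qed

text \<open>\<open>P\<close> is a continuous surjection from a compact space onto a Hausdorff one,
  hence a quotient map, so a continuous function constant on its fibres descends to a continuous
  function on \<open>K\<close>.\<close>

lemma gasket_embedding_image:
  "gasket_embedding w K ` cont_functions (top_of_set K) =
    {a \<in> word_algebra. \<forall>\<sigma> \<tau>. P \<sigma> = P \<tau> \<longrightarrow> a \<sigma> = a \<tau>}" (is "?L = ?R")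
proof
  have "gasket_embedding w K f \<in> word_algebra" if "f \<in> cont_functions (top_of_set K)" for f
    using that continuous_map_compose[OF continuous_coding, of euclidean f]
    unfolding word_algebra_iff gasket_embedding_def by (simp add: cont_functions_def)
  then show "?L \<subseteq> ?R"
    by (auto simp: gasket_embedding_def)
  show "?R \<subseteq> ?L"
  proof
    fix a assume a: "a \<in> ?R"
    \<comment> \<open>Any word in the fibre serves, as \<open>a\<close> is constant on fibres; the
      restriction makes \<open>f\<close> extensional on \<open>K\<close>.\<close>
    define f where "f = restrict (\<lambda>x. a (SOME \<sigma>. P \<sigma> = x)) K"
    have aP: "a = f \<circ> P"
    proof
      fix \<sigma>
      have "P (SOME \<tau>. P \<tau> = P \<sigma>) = P \<sigma>"
        by (rule someI[of _ \<sigma>]) simp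
      then have "a (SOME \<tau>. P \<tau> = P \<sigma>) = a \<sigma>"
        using a by blast
      then show "a \<sigma> = (f \<circ> P) \<sigma>"
        by (simp add: f_def coding_in_K)
    qed
    moreover have "continuous_map (top_of_set K) euclidean f"
      using a aP continuous_compose_quotient_map_eq[OF quotient_coding, of euclidean f]
      unfolding word_algebra_iff by blast
    ultimately show "a \<in> ?L"
      by (auto simp: gasket_embedding_def cont_functions_def f_def)
  qed
qed

text \<open>Constancy on fibres survives the pointwise operations, and also norm limits, because
  these are pointwise limits and limits are unique.\<close>

lemma cstar_subalgebra_gasket:
  "cstar_subalgebra (gasket_embedding w K ` cont_functions (top_of_set K))"
proof -
  have lim: "a \<sigma> = a \<tau>"
    if "norm_limit b a" "a \<in> word_algebra" "\<And>n. b n \<in> word_algebra" "\<And>n. b n \<sigma> = b n \<tau>"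
    for a b \<sigma> \<tau>
    using norm_limit_pointwise[of b a] that bounded_range_word_algebra
    by (metis (no_types, lifting) LIMSEQ_unique ext)
  have "(\<lambda>\<sigma>. a \<sigma> + b \<sigma>) \<in> word_algebra" "(\<lambda>\<sigma>. c * a \<sigma>) \<in> word_algebra"
    "(\<lambda>\<sigma>. a \<sigma> * b \<sigma>) \<in> word_algebra" "(\<lambda>\<sigma>. cnj (a \<sigma>)) \<in> word_algebra"
    if "a \<in> word_algebra" "b \<in> word_algebra" for a b and c :: complex
    using that unfolding word_algebra_iff continuous_map_atin limitin_canonical_iff
    by (auto intro!: tendsto_intros)
  note closed = this
  have zero: "(\<lambda>_. 0) \<in> word_algebra"
    by (simp add: word_algebra_iff)
  define A where "A = {a \<in> word_algebra. \<forall>\<sigma> \<tau>. P \<sigma> = P \<tau> \<longrightarrow> a \<sigma> = a \<tau>}"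
  have A_iff: "a \<in> A \<longleftrightarrow> a \<in> word_algebra \<and> (\<forall>\<sigma> \<tau>. P \<sigma> = P \<tau> \<longrightarrow> a \<sigma> = a \<tau>)" for a
    by (simp only: A_def mem_Collect_eq)
  have mem: "a \<in> word_algebra" and fibre: "P \<sigma> = P \<tau> \<Longrightarrow> a \<sigma> = a \<tau>" if "a \<in> A" for a \<sigma> \<tau>
    using that unfolding A_iff by iprover+
  have A_I: "a \<in> A" if "a \<in> word_algebra" "\<And>\<sigma> \<tau>. P \<sigma> = P \<tau> \<Longrightarrow> a \<sigma> = a \<tau>" for a
    using that unfolding A_iff by iprover
  have limit: "a \<in> A" if b: "\<forall>n. b n \<in> A" and a: "a \<in> word_algebra" "norm_limit b a" for a b
  proof (rule A_I[OF a(1)])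
    fix \<sigma> \<tau> assume "P \<sigma> = P \<tau>"
    then have "b n \<sigma> = b n \<tau>" for n
      by (rule fibre[OF b[rule_format]])
    then show "a \<sigma> = a \<tau>"
      by (rule lim[OF a(2,1) mem[OF b[rule_format]]])
  qed
  have ops: "(\<lambda>\<sigma>. a \<sigma> + b \<sigma>) \<in> A" "(\<lambda>\<sigma>. c * a \<sigma>) \<in> A"
    "(\<lambda>\<sigma>. a \<sigma> * b \<sigma>) \<in> A" "(\<lambda>\<sigma>. cnj (a \<sigma>)) \<in> A"
    if "a \<in> A" "b \<in> A" for a b and c :: complex
  proof -
    note closed = closed[OF mem[OF that(1)] mem[OF that(2)]]
    note fibre = fibre[OF that(1)] fibre[OF that(2)]
    show "(\<lambda>\<sigma>. a \<sigma> + b \<sigma>) \<in> A" "(\<lambda>\<sigma>. a \<sigma> * b \<sigma>) \<in> A"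
      by (intro A_I closed arg_cong2[where f = "(+)"] arg_cong2[where f = "(*)"] fibre; assumption)+
    show "(\<lambda>\<sigma>. c * a \<sigma>) \<in> A" "(\<lambda>\<sigma>. cnj (a \<sigma>)) \<in> A"
      by (intro A_I closed arg_cong[where f = "(*) c"] arg_cong[where f = cnj] fibre; assumption)+
  qed
  have zero_mem: "(\<lambda>_. 0) \<in> A"
    by (intro A_I zero refl)
  show ?thesis
    unfolding cstar_subalgebra_def gasket_embedding_image A_def[symmetric]
  proof (intro conjI subsetI allI ballI impI)
    show "a \<in> A" if "\<forall>n. b n \<in> A" "a \<in> word_algebra" "norm_limit b a" for a b
      using that by (rule limit)
  \<comment> \<open>\<open>ops\<close> speaks of two elements; the unary operations take the zero
    function as the second.\<close>
  qed (rule zero_mem | erule mem | erule (1) ops(1,3) | erule ops(2,4)[OF _ zero_mem])+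
qed

end

section \<open>Barycentric coordinates on the gasket\<close>

lemma dist_midpoint_square:
  fixes a b x :: "'a::real_inner"
  shows "4 * (dist x ((1/2) *\<^sub>R (a + b)))\<^sup>2 = 2 * (dist x a)\<^sup>2 + 2 * (dist x b)\<^sup>2 - (dist a b)\<^sup>2"
  by (simp add: dist_norm power2_norm_eq_inner inner_diff inner_add algebra_simps inner_commute)

lemma three_eq_0: "(3 :: 3) = 0" and four_eq_1: "(4 :: 3) = 1"
  by simp_all

lemma sum_cyclic_3: "sum f (UNIV :: 3 set) = f (i - 1) + f i + f (i + 1)"
  using exhaust_3[of i]
  by (elim disjE; simp add: sum_3 four_eq_1 ac_simps flip: three_eq_0)

lemma cyclic_3: "k = i - 1 \<or> k = i \<or> k = i + 1" for i k :: 3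
  using exhaust_3[of i] exhaust_3[of k] by auto

locale gasket = half_ifs +
  fixes v :: "3 \<Rightarrow> real^2"
  assumes distinct: "v 1 \<noteq> v 2"
    and equilateral: "dist (v 1) (v 2) = dist (v 2) (v 3)" "dist (v 2) (v 3) = dist (v 3) (v 1)"
    and w_v2: "w j (v 2) = v j"
    and w_v3: "w j (v 3) = (1/2) *\<^sub>R (v j + v (j + 1))"
    and w_v1: "w j (v 1) = (1/2) *\<^sub>R (v j + v (j - 1))"
begin

text \<open>
  On the plane, \<open>bary k\<close> is the barycentric coordinate with respect to \<open>v k\<close>: in an equilateral
  triangle it is an affine function of the squared distances to the vertices.  Written this way,
  its behaviour under a similitude follows without knowing that similitudes are affine.
\<close>

definition bary :: "3 \<Rightarrow> real^2 \<Rightarrow> real" where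
  "bary k x = 1/3 + ((\<Sum>i\<in>UNIV. (dist x (v i))\<^sup>2) - 3 * (dist x (v k))\<^sup>2) / (3 * (dist (v 1) (v 2))\<^sup>2)"

lemma side_pos: "dist (v 1) (v 2) > 0"
  using distinct by simp

lemma side: "i \<noteq> j \<Longrightarrow> dist (v i) (v j) = dist (v 1) (v 2)"
  using equilateral exhaust_3[of i] exhaust_3[of j] by (auto simp: dist_commute)

lemma bary_sum: "bary (i - 1) x + bary i x + bary (i + 1) x = 1"
  using side_pos by (simp add: bary_def sum_cyclic_3[of _ i] field_simps)

text \<open>If \<open>x\<close> has weights b1, b2, b3, its image is b2 times \<open>v i\<close>
  plus b3 and b1 times the midpoints of \<open>v i\<close> with \<open>v (i + 1)\<close> and
  \<open>v (i - 1)\<close>. The weight of \<open>v i\<close> is thus b2 + (b1 + b3)/2 = 1/2 +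
  b2/2.\<close>

lemma bary_w:
  "bary i (w i x) = 1/2 + bary 2 x / 2"
  "bary (i + 1) (w i x) = bary 3 x / 2"
  "bary (i - 1) (w i x) = bary 1 x / 2"
proof -
  let ?s = "(dist (v 1) (v 2))\<^sup>2"
  have ne: "i \<noteq> i + 1" "i \<noteq> i - 1"
    using exhaust_3[of i] by auto
  have D: "(dist (w i x) (v i))\<^sup>2 = (dist x (v 2))\<^sup>2 / 4"
    using dist_w[of i x "v 2"] unfolding w_v2 by (simp only: power_divide) simp
  have "(dist (w i x) (w i (v 3)))\<^sup>2 = (dist x (v 3))\<^sup>2 / 4"
    by (simp add: dist_w power_divide)
  \<comment> \<open>\<open>w i (v 3)\<close> is the midpoint of \<open>v i\<close> and
    \<open>v (i + 1)\<close>. Apollonius' median identity gives the distance to the far end from the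
    side and the distances to the midpoint and to \<open>v i\<close>; \<open>D_pred\<close> is
    analogous.\<close>
  then have D_succ: "(dist (w i x) (v (i + 1)))\<^sup>2 =
      (dist x (v 3))\<^sup>2 / 2 + ?s / 2 - (dist x (v 2))\<^sup>2 / 4"
    using dist_midpoint_square[of "w i x" "v i" "v (i + 1)"] unfolding w_v3 side[OF ne(1)] D
    by linarith
  have "(dist (w i x) (w i (v 1)))\<^sup>2 = (dist x (v 1))\<^sup>2 / 4"
    by (simp add: dist_w power_divide)
  then have D_pred: "(dist (w i x) (v (i - 1)))\<^sup>2 =
      (dist x (v 1))\<^sup>2 / 2 + ?s / 2 - (dist x (v 2))\<^sup>2 / 4"
    using dist_midpoint_square[of "w i x" "v i" "v (i - 1)"] unfolding w_v1 side[OF ne(2)] D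
    by linarith
  have "?s \<noteq> 0"
    using side_pos by simp
  then show "bary i (w i x) = 1/2 + bary 2 x / 2" "bary (i + 1) (w i x) = bary 3 x / 2"
    "bary (i - 1) (w i x) = bary 1 x / 2"
    unfolding bary_def sum_cyclic_3[of "\<lambda>k. (dist (w i x) (v k))\<^sup>2" i] D D_succ D_pred sum_3
    by (simp_all add: field_simps)
qed

lemma continuous_bary: "continuous_on S (bary k)"
  unfolding bary_def using side_pos by (intro continuous_intros) auto

text \<open>
  A negative minimum of the coordinates over \<open>K\<close> is impossible, since the point where it is
  attained has a preimage in \<open>K\<close> with a coordinate twice as negative.
\<close>

lemma bary_nonneg:
  assumes "x \<in> K"
  shows "bary k x \<ge> 0"
proof -
  have "\<exists>z\<in>K. \<forall>y\<in>K. bary j z \<le> bary j y" for j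
    using continuous_attains_inf[OF compact nonempty continuous_bary] .
  then obtain z where z: "\<And>j. z j \<in> K" "\<And>j y. y \<in> K \<Longrightarrow> bary j (z j) \<le> bary j y"
    by metis
  define m where "m = Min (range (\<lambda>j. bary j (z j)))"
  have m_le: "m \<le> bary j y" if "y \<in> K" for j y
  proof -
    have "m \<le> bary j (z j)"
      unfolding m_def by (rule Min_le) auto
    also have "\<dots> \<le> bary j y"
      by (rule z(2)[OF that])
    finally show ?thesis .
  qed
  have "m \<in> range (\<lambda>j. bary j (z j))"
    unfolding m_def by (intro Min_in) auto
  then obtain j where j: "m = bary j (z j)"
    by blast
  obtain i y where y: "y \<in> K" "z j = w i y"
    by (rule K_cases[OF z(1)[of j]])
  have "m = bary j (w i y)"
    using j y(2) by simp
  then have "m = bary 1 y / 2 \<or> m = 1/2 + bary 2 y / 2 \<or> m = bary 3 y / 2"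
    using cyclic_3[of j i] bary_w[of i y] by auto
  then have "m \<ge> 0"
    using m_le[OF y(1), of 1] m_le[OF y(1), of 2] m_le[OF y(1), of 3] by linarith
  then show ?thesis
    using m_le[OF assms, of k] by linarith
qed

section \<open>Words with the same image under the coding map\<close>

lemma bary_coding_eq_1_step:
  assumes "bary a (P \<sigma>) = 1"
  shows "\<sigma> 0 = a \<and> bary 2 (P (\<sigma> \<circ> Suc)) = 1"
proof -
  let ?i = "\<sigma> 0" and ?x = "P (\<sigma> \<circ> Suc)"
  note shift = coding_shift[of \<sigma>]
  have nonneg: "bary k ?x \<ge> 0" for k
    by (simp add: bary_nonneg coding_in_K)
  have "bary 1 ?x + bary 2 ?x + bary 3 ?x = 1"
    using bary_sum[of 2 ?x] by simp
  \<comment> \<open>The coordinates of \<open>?x\<close> are at most 1, so a coordinate of the image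
    other than \<open>?i\<close> is at most 1/2. Hence \<open>a = ?i\<close>, and
    \<open>1/2 + bary 2 ?x / 2 = 1\<close>.\<close>
  then show ?thesis
    using cyclic_3[of a ?i] assms nonneg[of 1] nonneg[of 2] nonneg[of 3]
    unfolding shift by (auto simp: bary_w)
qed

text \<open>A corner has a single address: by the previous step the tail codes the corner with index
  2, and so does every further tail.\<close>

lemma bary_coding_eq_1:
  assumes "bary a (P \<sigma>) = 1"
  shows "\<sigma> 0 = a" "n > 0 \<Longrightarrow> \<sigma> n = 2"
proof -
  show "\<sigma> 0 = a"
    using bary_coding_eq_1_step[OF assms] by simp
  have "\<sigma> (Suc n) = 2" for n
    using assms
  proof (induction n arbitrary: \<sigma> a)
    case 0
    then show ?case
      using bary_coding_eq_1_step bary_coding_eq_1_step by fastforce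
  next
    case (Suc n)
    then show ?case
      using bary_coding_eq_1_step by fastforce
  qed
  then show "n > 0 \<Longrightarrow> \<sigma> n = 2"
    by (metis gr0_conv_Suc)
qed

lemma vertex_point_fixed:
  assumes "\<And>n. n > 0 \<Longrightarrow> \<sigma> n = 2"
  shows "vertex_point v w n \<sigma> = v (\<sigma> 0)"
  using assms
proof (induction n arbitrary: \<sigma>)
  case (Suc n)
  then show ?case
    using Suc.IH[of "\<sigma> \<circ> Suc"] by (simp add: vertex_point_Suc w_v2)
qed (simp add: vertex_point_0)

text \<open>Neighbouring first-level cells meet only in a midpoint, whose addresses in them continue
  with \<open>3 2 2 2 ...\<close> and \<open>1 2 2 2 ...\<close>. Agreement starts at level 1: at
  level 0 the evaluation points are the distinct vertices \<open>v (\<sigma> 0)\<close> and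
  \<open>v (\<tau> 0)\<close>.\<close>

lemma vertex_point_eq_if_succ:
  assumes eq: "P \<sigma> = P \<tau>" and succ: "\<tau> 0 = \<sigma> 0 + 1"
  shows "vertex_point v w (Suc n) \<sigma> = vertex_point v w (Suc n) \<tau>"
proof -
  let ?i = "\<sigma> 0" and ?x = "P (\<sigma> \<circ> Suc)" and ?y = "P (\<tau> \<circ> Suc)"
  have i: "?i + 1 + 1 = ?i - 1" "?i + 1 - 1 = ?i"
    using exhaust_3[of ?i] by (elim disjE; simp)+
  have wxy: "w ?i ?x = w (?i + 1) ?y"
    using eq unfolding coding_shift[of \<sigma>] coding_shift[of \<tau>] succ .
  have nonneg: "bary k ?x \<ge> 0" "bary k ?y \<ge> 0" for k
    by (simp_all add: bary_nonneg coding_in_K)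
  have sums: "bary 1 ?x + bary 2 ?x + bary 3 ?x = 1" "bary 1 ?y + bary 2 ?y + bary 3 ?y = 1"
    using bary_sum[of 2] by simp_all
  \<comment> \<open>Coordinates \<open>?i\<close> and \<open>?i + 1\<close> of the common point,
    computed in both cells. They give \<open>bary 1 ?y \<ge> 1\<close> and
    \<open>bary 3 ?x \<ge> 1\<close>; the sums force equality.\<close>
  have "1/2 + bary 2 ?x / 2 = bary 1 ?y / 2" "bary 3 ?x / 2 = 1/2 + bary 2 ?y / 2"
    using bary_w[of ?i ?x] bary_w[of "?i + 1" ?y] unfolding wxy i by simp_all
  then have "bary 3 ?x = 1" "bary 1 ?y = 1"
    using sums nonneg[of 1] nonneg[of 2] nonneg[of 3] by linarith+
  then have \<sigma>: "\<sigma> 1 = 3" "\<And>n. n > 0 \<Longrightarrow> (\<sigma> \<circ> Suc) n = 2"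
    and \<tau>: "\<tau> 1 = 1" "\<And>n. n > 0 \<Longrightarrow> (\<tau> \<circ> Suc) n = 2"
    using bary_coding_eq_1[of 3 "\<sigma> \<circ> Suc"] bary_coding_eq_1[of 1 "\<tau> \<circ> Suc"] by auto
  have "vertex_point v w (Suc n) \<sigma> = w ?i (v 3)" "vertex_point v w (Suc n) \<tau> = w (?i + 1) (v 1)"
    using vertex_point_fixed[of "\<sigma> \<circ> Suc" n] vertex_point_fixed[of "\<tau> \<circ> Suc" n] \<sigma> \<tau> succ
    by (simp_all add: vertex_point_Suc)
  then show ?thesis
    by (simp add: w_v1 w_v3 add.commute)
qed

text \<open>Injectivity of \<open>w j\<close> strips the common prefix until the first difference,
  where the previous lemma applies. The position \<open>m\<close> may be any difference, so the
  induction can stop early.\<close>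

lemma vertex_point_eq:
  assumes "P \<sigma> = P \<tau>" "\<sigma> m \<noteq> \<tau> m" "n > m"
  shows "vertex_point v w n \<sigma> = vertex_point v w n \<tau>"
  using assms
proof (induction m arbitrary: \<sigma> \<tau> n)
  case 0
  obtain k where k: "n = Suc k"
    using "0.prems" gr0_conv_Suc by blast
  \<comment> \<open>Modulo 3, distinct letters are always neighbours, in one order or the
    other.\<close>
  consider "\<tau> 0 = \<sigma> 0 + 1" | "\<sigma> 0 = \<tau> 0 + 1"
    using cyclic_3[of "\<sigma> 0" "\<tau> 0"] "0.prems"(2) by force
  then show ?case
    using vertex_point_eq_if_succ[of \<sigma> \<tau> k] vertex_point_eq_if_succ[of \<tau> \<sigma> k] "0.prems"(1) k
    by cases auto
next
  case (Suc m)
  obtain k where k: "n = Suc k"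
    using Suc.prems gr0_conv_Suc by (metis less_imp_Suc_add)
  show ?case
  proof (cases "\<sigma> 0 = \<tau> 0")
    case True
    then have eq: "P (\<sigma> \<circ> Suc) = P (\<tau> \<circ> Suc)"
      using Suc.prems(1) coding_shift[of \<sigma>] coding_shift[of \<tau>] by (simp add: w_inject)
    have "vertex_point v w k (\<sigma> \<circ> Suc) = vertex_point v w k (\<tau> \<circ> Suc)"
      using Suc.prems k by (intro Suc.IH eq) auto
    then show ?thesis
      using True by (simp add: k vertex_point_Suc)
  next
    case False
    consider "\<tau> 0 = \<sigma> 0 + 1" | "\<sigma> 0 = \<tau> 0 + 1"
      using cyclic_3[of "\<sigma> 0" "\<tau> 0"] False by force
    then show ?thesis
      using vertex_point_eq_if_succ[of \<sigma> \<tau> k] vertex_point_eq_if_succ[of \<tau> \<sigma> k] Suc.prems(1) k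
      by cases auto
  qed
qed

section \<open>Approximation by vertex functions and the identification of the limits\<close>

lemma v_in_K: "v j \<in> K"
proof -
  obtain x where x: "x \<in> K"
    using nonempty by blast
  \<comment> \<open>Iterating the contraction \<open>w 2\<close> from a point of \<open>K\<close>
    converges to its fixed point \<open>v 2\<close>, which the closed set \<open>K\<close> therefore
    contains.\<close>
  have mem: "(w 2 ^^ n) x \<in> K" for n
    by (induction n) (auto simp: x w_in_K)
  have "dist ((w 2 ^^ n) x) (v 2) = dist x (v 2) * (1/2) ^ n" for n
  proof (induction n)
    case (Suc n)
    then show ?case
      using dist_w[of 2 "(w 2 ^^ n) x" "v 2"] by (simp add: w_v2)
  qed simp
  moreover have "(\<lambda>n. dist x (v 2) * (1/2) ^ n) \<longlonglongrightarrow> dist x (v 2) * 0"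
    by (intro tendsto_intros LIMSEQ_power_zero) auto
  ultimately have "(\<lambda>n. (w 2 ^^ n) x) \<longlonglongrightarrow> v 2"
    by (subst tendsto_dist_iff) simp
  then have "v 2 \<in> K"
    by (rule closed_sequentially[OF compact_imp_closed[OF compact] mem])
  then show ?thesis
    using w_in_K[of "v 2" j] by (simp add: w_v2)
qed

lemma vertex_point_in_K: "vertex_point v w n \<sigma> \<in> K"
  by (induction n arbitrary: \<sigma>) (auto simp: vertex_point_0 vertex_point_Suc v_in_K w_in_K)

text \<open>At level 0 both points lie in \<open>K\<close>, and each further outer map halves their
  distance. The bound is uniform in the word, so uniform continuity turns it into norm
  convergence.\<close>

lemma dist_vertex_point: "dist (vertex_point v w n \<sigma>) (P \<sigma>) \<le> diameter K / 2 ^ n"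
proof (induction n arbitrary: \<sigma>)
  case 0
  then show ?case
    by (simp add: dist_le_diameter vertex_point_in_K coding_in_K)
next
  case (Suc n)
  then show ?case
    using Suc[of "\<sigma> \<circ> Suc"] by (simp add: coding_shift[of \<sigma>] vertex_point_Suc dist_w)
qed

lemma gasket_embedding_is_limit:
  assumes "f \<in> cont_functions (top_of_set K)"
  shows "norm_limit (\<lambda>n. vertex_embedding v w n (restrict f (vertices v w n))) (gasket_embedding w K f)"
proof (rule norm_limitI)
  fix e :: real assume "e > 0"
  have "uniformly_continuous_on K f"
    using assms compact by (auto simp: cont_functions_def intro: compact_uniformly_continuous)
  then obtain d where d: "d > 0" "\<And>x y. x \<in> K \<Longrightarrow> y \<in> K \<Longrightarrow> dist y x < d \<Longrightarrow> dist (f y) (f x) < e"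
    using \<open>e > 0\<close> unfolding uniformly_continuous_on_def by metis
  obtain N where N: "\<And>n. n \<ge> N \<Longrightarrow> diameter K / 2 ^ n < d"
    using small_scale[OF d(1)] by blast
  have "cmod (f (vertex_point v w n \<sigma>) - f (P \<sigma>)) \<le> e" if "n \<ge> N" for n \<sigma>
    using d(2)[OF coding_in_K vertex_point_in_K, of n \<sigma> \<sigma>] dist_vertex_point[of n \<sigma>] N[OF that]
    by (simp add: dist_norm)
  then show "\<exists>N. \<forall>n\<ge>N. \<forall>x. cmod (vertex_embedding v w n (restrict f (vertices v w n)) x
      - gasket_embedding w K f x) \<le> e"
    by (auto simp: vertex_embedding_eq gasket_embedding_def vertex_point_in_vertices)
qed

text \<open>Beyond a position where the words differ, their evaluation points coincide, so both
  values are limits of eventually equal sequences, whichever functions \<open>b n\<close> are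
  chosen.\<close>

lemma limit_constant_on_fibres:
  assumes "norm_limit (\<lambda>n. vertex_embedding v w n (b n)) a" "a \<in> word_algebra" "P \<sigma> = P \<tau>"
  shows "a \<sigma> = a \<tau>"
proof (cases "\<sigma> = \<tau>")
  case False
  then obtain m where m: "\<sigma> m \<noteq> \<tau> m"
    by blast
  have lim: "(\<lambda>n. vertex_embedding v w n (b n) \<rho>) \<longlonglongrightarrow> a \<rho>" for \<rho>
    by (rule norm_limit_pointwise[OF assms(1) bounded_range_vertex_embedding
          bounded_range_word_algebra[OF assms(2)]])
  have "\<forall>\<^sub>F n in sequentially. vertex_embedding v w n (b n) \<sigma> = vertex_embedding v w n (b n) \<tau>"
    using eventually_gt_at_top[of m]
    by eventually_elim (simp add: vertex_embedding_eq vertex_point_eq[OF assms(3) m])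
  then have "(\<lambda>n. vertex_embedding v w n (b n) \<tau>) \<longlonglongrightarrow> a \<sigma>"
    using lim[of \<sigma>] by (simp add: tendsto_cong)
  then show ?thesis
    using lim[of \<tau>] LIMSEQ_unique by blast
qed simp

lemma gasket_embedding_image_eq_limits:
  "gasket_embedding w K ` cont_functions (top_of_set K) =
    {a \<in> word_algebra. \<exists>b. (\<forall>n. b n \<in> vertices v w n \<rightarrow>\<^sub>E (UNIV :: complex set)) \<and>
       norm_limit (\<lambda>n. vertex_embedding v w n (b n)) a}" (is "?L = ?R")
proof
  show "?L \<subseteq> ?R"
  proof
    fix a assume a: "a \<in> ?L"
    then obtain f where f: "f \<in> cont_functions (top_of_set K)" "a = gasket_embedding w K f"
      by blast
    show "a \<in> ?R"
    proof (intro CollectI conjI exI[of _ "\<lambda>n. restrict f (vertices v w n)"] allI)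
      show "a \<in> word_algebra"
        using a unfolding gasket_embedding_image by (elim CollectE conjE)
      show "restrict f (vertices v w n) \<in> vertices v w n \<rightarrow>\<^sub>E UNIV" for n
        by simp
      show "norm_limit (\<lambda>n. vertex_embedding v w n (restrict f (vertices v w n))) a"
        unfolding f(2) by (rule gasket_embedding_is_limit[OF f(1)])
    qed
  qed
  show "?R \<subseteq> ?L"
    unfolding gasket_embedding_image
    by (intro Collect_mono impI conjI allI; elim conjE exE)
      (assumption, rule limit_constant_on_fibres)
qed

end

theorem theorem2p1:
  fixes v :: "3 \<Rightarrow> real^2"
    and w :: "3 \<Rightarrow> real^2 \<Rightarrow> real^2"
    and K :: "(real^2) set"
  assumes equilateral: "v 1 \<noteq> v 2"
      "dist (v 1) (v 2) = dist (v 2) (v 3)" "dist (v 2) (v 3) = dist (v 3) (v 1)"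
    and similitudes: "\<And>j. similitude (1/2) (w j)"
      "\<And>j. w j (v 2) = v j"
      "\<And>j. w j (v 3) = (1/2) *\<^sub>R (v j + v (j + 1))"
      "\<And>j. w j (v 1) = (1/2) *\<^sub>R (v j + v (j - 1))"
    and gasket: "K \<noteq> {}" "compact K" "K = w 1 ` K \<union> w 2 ` K \<union> w 3 ` K"
  shows "inj_on (gasket_embedding w K) (cont_functions (top_of_set K)) \<and>
    cstar_subalgebra (gasket_embedding w K ` cont_functions (top_of_set K)) \<and>
    gasket_embedding w K ` cont_functions (top_of_set K) =
      {a \<in> word_algebra. \<exists>b. (\<forall>n. b n \<in> vertices v w n \<rightarrow>\<^sub>E (UNIV :: complex set)) \<and>
         norm_limit (\<lambda>n. vertex_embedding v w n (b n)) a}"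
proof -
  interpret gasket w K v
    by (unfold_locales; fact assms)
  show ?thesis
    using inj_gasket_embedding cstar_subalgebra_gasket gasket_embedding_image_eq_limits by blast
qed


end
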